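(* For infinitely many positive integers $t$, \[\tilde{r}(t) \leq 1.001^{-t} \binom{r(t)}{2}.\]
   Context: $r(t)$ denotes the diagonal Ramsey number of $K_t$: the smallest $n$ such that every red/blue colouring of the edges of $K_n$ contains a monochromatic copy of $K_t$. The on-line Ramsey number $\tilde{r}(G)$ of a graph $G$ is defined via the following game between Builder and Painter, played on an initially edgeless graph with an unlimited supply of vertices: in each round Builder draws a new edge (between any two vertices not yet joined), and Painter immediately colours it red or blue. Builder wins once the coloured graph contains a monochromatic copy of $G$. $\tilde{r}(G)$ is the minimum number of edges Builder must draw to guarantee a win, regardless of Painter's strategy. We write $\tilde{r}(t) = \tilde{r}(K_t)$. *)

theory Defs
  imports Complex_Main "HOL-Library.Ramsey"
begin

datatype colour = Red | Blue

text \<open>In \<^term>\<open>partn {..<n} t 2 {Red, Blue}\<close> a colouring of the edges of \<open>K\<^sub>n\<close> is a colouring of the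
  2-element subsets of \<^term>\<open>{..<n::nat}\<close>, and a monochromatic \<open>K\<^sub>t\<close> is a \<open>t\<close>-element set of vertices
  all of whose pairs have the same colour. Such an \<open>n\<close> exists by Ramsey's theorem, so the
  \<open>LEAST\<close> is attained.\<close>

definition ramsey_number :: "nat \<Rightarrow> nat" where
  "ramsey_number t = (LEAST n. partn {..<n} t 2 {Red, Blue})"


text \<open>A graph is a pair of a vertex set and a set of edges, the edges being 2-element sets of
  vertices. The board of the on-line game is the infinite vertex set \<^typ>\<open>nat\<close>. A position is the
  list of the edges drawn so far with their colours, oldest first.\<close>

type_synonym 'a graph = "'a set \<times> 'a set set"
type_synonym edge = "nat set"
type_synonym history = "(edge \<times> colour) list"
type_synonym builder = "history \<Rightarrow> edge"
type_synonym painter = "history \<Rightarrow> edge \<Rightarrow> colour"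

definition complete_graph :: "nat \<Rightarrow> nat graph" where
  "complete_graph t = ({..<t}, nsets {..<t} 2)"

definition contains_copy :: "edge set \<Rightarrow> 'a graph \<Rightarrow> bool" where
  "contains_copy F G \<longleftrightarrow> (\<exists>\<phi> :: 'a \<Rightarrow> nat. inj_on \<phi> (fst G) \<and> (\<forall>e \<in> snd G. \<phi> ` e \<in> F))"

definition colour_class :: "colour \<Rightarrow> history \<Rightarrow> edge set" where
  "colour_class c h = {e. (e, c) \<in> set h}"

definition has_mono_copy :: "history \<Rightarrow> 'a graph \<Rightarrow> bool" where
  "has_mono_copy h G \<longleftrightarrow> (\<exists>c. contains_copy (colour_class c h) G)"

text \<open>Builder must always draw a genuinely new edge. Quantifying over all lists \<open>h\<close>, including
  unreachable ones, is harmless: a finite list never exhausts the pairs of vertices.\<close>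

definition legal_builder :: "builder \<Rightarrow> bool" where
  "legal_builder \<sigma> \<longleftrightarrow> (\<forall>h. \<sigma> h \<in> nsets UNIV 2 \<and> \<sigma> h \<notin> fst ` set h)"

primrec play :: "builder \<Rightarrow> painter \<Rightarrow> nat \<Rightarrow> history" where
  "play \<sigma> \<tau> 0 = []"
| "play \<sigma> \<tau> (Suc n) =
     (let h = play \<sigma> \<tau> n; e = \<sigma> h in h @ [(e, \<tau> h e)])"

definition builder_wins_within :: "'a graph \<Rightarrow> nat \<Rightarrow> bool" where
  "builder_wins_within G n \<longleftrightarrow>
     (\<exists>\<sigma>. legal_builder \<sigma> \<and> (\<forall>\<tau>. \<exists>k\<le>n. has_mono_copy (play \<sigma> \<tau> k) G))"

text \<open>For a finite graph \<open>G\<close> the \<open>LEAST\<close> is attained: Builder can draw all edges of a sufficiently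
  large complete graph.\<close>

definition online_ramsey :: "'a graph \<Rightarrow> nat" where
  "online_ramsey G = (LEAST n. builder_wins_within G n)"

abbreviation online_ramsey_number :: "nat \<Rightarrow> nat" where
  "online_ramsey_number t \<equiv> online_ramsey (complete_graph t)"

end

theory Submission
  imports Defs "HOL-Real_Asymp.Real_Asymp"
begin

text \<open>Builder maintains a set \<open>S\<close> of vertices, a red clique joined to \<open>S\<close> in red and a blue clique
  joined to \<open>S\<close> in blue. She draws all edges from a vertex of \<open>S\<close> to the rest of \<open>S\<close> and passes to one
  of the two neighbourhoods, giving up a factor \<open>10\<close> if this enlarges a clique with fewer than
  \<open>m = t / 100\<close> vertices, and only a factor \<open>8/7\<close> otherwise. Once both cliques have \<open>m\<close> vertices, she draws a
  complete graph on \<open>r(t - m)\<close> vertices of \<open>S\<close>. As \<open>r(t)\<close> is at least about \<open>2 powr (t / 2)\<close>, there is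
  exponential room between \<open>r(t)\<close> and \<open>r(t)\<^sup>2\<close>, which pays for the star moves. The same lower bound shows that
  \<open>r(t - m)\<close> is exponentially smaller than \<open>r(t)\<close> for infinitely many \<open>t\<close>, and for these the final
  complete graph is cheap as well.\<close>

section \<open>Ramsey numbers\<close>

lemma UNIV_colour: "(UNIV :: colour set) = {Red, Blue}"
  using colour.exhaust by auto

text \<open>Ramsey's theorem is available for the colours 0 and 1; translating them to
  \<open>Red\<close> and \<open>Blue\<close> shows that the \<open>LEAST\<close> is
  attained.\<close>

lemma partn_ramsey_number: "partn {..<ramsey_number t} t 2 {Red, Blue}"
proof -
  obtain N :: nat where "partn_lst {..<N} [t, t] 2"
    using ramsey_full by blast
  then have N: "partn {..<N} t 2 {..<2::nat}"
    by (simp add: partn_lst_eq_partn)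
  have "partn {..<N} t 2 {Red, Blue}"
    unfolding partn_def monochromatic_def
  proof
    fix f :: "nat set \<Rightarrow> colour"
    define g where "g e = (if f e = Red then 0 else 1 :: nat)" for e
    have "g \<in> nsets {..<N} 2 \<rightarrow> {..<2}"
      by (auto simp: g_def)
    then obtain i H where H: "H \<in> nsets {..<N} t" "g ` nsets H 2 \<subseteq> {i}"
      using N unfolding partn_def monochromatic_def by blast
    have "f ` nsets H 2 \<subseteq> {if i = 0 then Red else Blue}"
    proof
      fix c assume "c \<in> f ` nsets H 2"
      then obtain e where "e \<in> nsets H 2" "c = f e"
        by auto
      moreover from this H(2) have "g e = i"
        by blast
      ultimately show "c \<in> {if i = 0 then Red else Blue}"
        by (cases c) (auto simp: g_def)
    qed
    with H(1) show "\<exists>\<xi>\<in>{Red, Blue}. \<exists>H\<in>nsets {..<N} t. f ` nsets H 2 \<subseteq> {\<xi>}"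
      by (intro bexI[of _ "if i = 0 then Red else Blue"] bexI[of _ H]) auto
  qed
  then show ?thesis
    unfolding ramsey_number_def by (rule LeastI)
qed

text \<open>Transport along a bijection makes the Ramsey property usable on any vertex set of the
  right size.\<close>

lemma ramsey_number_mono_subset:
  fixes f :: "'a set \<Rightarrow> colour"
  assumes "finite S" "card S = ramsey_number t"
  obtains c H where "H \<in> nsets S t" "\<And>e. e \<in> nsets H 2 \<Longrightarrow> f e = c"
proof -
  obtain \<phi> where \<phi>: "bij_betw \<phi> {..<ramsey_number t} S"
    using assms by (metis bij_betw_iff_card card_lessThan finite_lessThan)
  have "(\<lambda>e. f (\<phi> ` e)) \<in> nsets {..<ramsey_number t} 2 \<rightarrow> {Red, Blue}"
    using UNIV_colour by auto
  then obtain c H where H: "H \<in> nsets {..<ramsey_number t} t"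
      "(\<lambda>e. f (\<phi> ` e)) ` nsets H 2 \<subseteq> {c}"
    using partn_ramsey_number[of t] unfolding partn_def monochromatic_def by blast
  have inj: "inj_on \<phi> H"
    using \<phi> H(1) unfolding bij_betw_def nsets_def by (auto intro: inj_on_subset)
  have "\<phi> ` H \<in> nsets S t"
    using H(1) \<phi> inj by (auto simp: nsets_def bij_betw_def card_image)
  moreover have "f e = c" if "e \<in> nsets (\<phi> ` H) 2" for e
  proof -
    have "bij_betw \<phi> H (\<phi> ` H)"
      using inj by (simp add: bij_betw_def)
    then have "nsets (\<phi> ` H) 2 = (\<lambda>X. \<phi> ` X) ` nsets H 2"
      using bij_betw_nsets by (metis bij_betw_def)
    with that H(2) show ?thesis by auto
  qed
  ultimately show thesis by (rule that)
qed

lemma ramsey_number_ge: "t \<le> ramsey_number t"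
proof -
  obtain H where "H \<in> nsets {..<ramsey_number t} t"
    using ramsey_number_mono_subset[of "{..<ramsey_number t}" t "\<lambda>_. Red"]
    by (metis card_lessThan finite_lessThan)
  then have "card H = t" "H \<subseteq> {..<ramsey_number t}"
    by (auto simp: nsets_def)
  then show ?thesis
    by (metis card_lessThan card_mono finite_lessThan)
qed

section \<open>Exponential lower bound for Ramsey numbers\<close>

lemma card_Pow_supersets:
  assumes "finite E" "F \<subseteq> E"
  shows "card {R \<in> Pow E. F \<subseteq> R} = 2 ^ (card E - card F)"
    and "card {R \<in> Pow E. F \<inter> R = {}} = 2 ^ (card E - card F)"
proof -
  have fin: "finite (E - F)" "card (E - F) = card E - card F"
    using assms finite_subset by (auto intro: card_Diff_subset)
  have "bij_betw (\<lambda>R. R \<union> F) (Pow (E - F)) {R \<in> Pow E. F \<subseteq> R}"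
    using assms by (intro bij_betw_byWitness[where f' = "\<lambda>R. R - F"]) auto
  then show "card {R \<in> Pow E. F \<subseteq> R} = 2 ^ (card E - card F)"
    using fin by (metis bij_betw_same_card card_Pow)
  have "{R \<in> Pow E. F \<inter> R = {}} = Pow (E - F)"
    by auto
  then show "card {R \<in> Pow E. F \<inter> R = {}} = 2 ^ (card E - card F)"
    using fin by (simp add: card_Pow)
qed

text \<open>Erdos's counting argument: every colouring of \<open>K_n\<close> makes some
  \<open>t\<close>-set monochromatic, and each \<open>t\<close>-set is monochromatic in at most a
  fraction \<open>2 / 2 ^ (t choose 2)\<close> of all colourings.\<close>

lemma partn_imp_pow_le:
  fixes n t :: nat
  assumes "partn {..<n} t 2 {Red, Blue}"
  shows "2 ^ (t choose 2) \<le> 2 * n ^ t"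
proof -
  let ?E = "nsets {..<n} 2"
  \<comment> \<open>A colouring is encoded by its set \<open>R\<close> of red edges;
    \<open>?A H\<close> collects the colourings in which \<open>H\<close> is monochromatic.\<close>
  let ?A = "\<lambda>H. {R \<in> Pow ?E. nsets H 2 \<subseteq> R} \<union> {R \<in> Pow ?E. nsets H 2 \<inter> R = {}}"
  have finE: "finite ?E"
    by (simp add: finite_imp_finite_nsets)
  have mono: "\<exists>H \<in> nsets {..<n} t. R \<in> ?A H" if "R \<subseteq> ?E" for R
  proof -
    have "(\<lambda>e. if e \<in> R then Red else Blue) \<in> ?E \<rightarrow> {Red, Blue}"
      by auto
    then obtain c H where "H \<in> nsets {..<n} t"
        "(\<lambda>e. if e \<in> R then Red else Blue) ` nsets H 2 \<subseteq> {c}"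
      using assms unfolding partn_def monochromatic_def by blast
    then have "R \<in> ?A H"
      using that by (cases c) (auto split: if_splits)
    with \<open>H \<in> _\<close> show ?thesis by blast
  qed
  then obtain H0 where "H0 \<in> nsets {..<n} t"
    by blast
  then have "H0 \<subseteq> {..<n}" "card H0 = t"
    by (auto simp: nsets_def)
  then have tn: "t \<le> n"
    using card_mono[of "{..<n}" H0] by simp
  have card_A: "card (?A H) \<le> 2 * 2 ^ ((n choose 2) - (t choose 2))"
    if "H \<in> nsets {..<n} t" for H
  proof -
    have H: "H \<subseteq> {..<n}" "card H = t"
      using that by (auto simp: nsets_def)
    have sub: "nsets H 2 \<subseteq> ?E" and cH: "card (nsets H 2) = t choose 2"
      using nsets_mono[OF H(1)] H(2) by auto
    show ?thesis
      using card_Un_le[of "{R \<in> Pow ?E. nsets H 2 \<subseteq> R}" "{R \<in> Pow ?E. nsets H 2 \<inter> R = {}}"]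
      unfolding card_Pow_supersets[OF finE sub] cH by simp
  qed
  have "Pow ?E \<subseteq> (\<Union>H \<in> nsets {..<n} t. ?A H)"
    using mono by (intro subsetI) (simp only: Pow_iff UN_iff)
  then have "card (Pow ?E) \<le> card (\<Union>H \<in> nsets {..<n} t. ?A H)"
    using finE by (intro card_mono) (auto simp: finite_imp_finite_nsets)
  also have "\<dots> \<le> (\<Sum>H \<in> nsets {..<n} t. card (?A H))"
    by (intro card_UN_le) (simp add: finite_imp_finite_nsets)
  also have "\<dots> \<le> (n choose t) * (2 * 2 ^ ((n choose 2) - (t choose 2)))"
    using sum_bounded_above[of "nsets {..<n} t" "\<lambda>H. card (?A H)", OF card_A]
    by (simp only: card_nsets card_lessThan of_nat_id)
  finally have "2 ^ (n choose 2) \<le> (n choose t) * (2 * 2 ^ ((n choose 2) - (t choose 2)))"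
    using finE by (simp add: card_Pow)
  moreover have "t choose 2 \<le> n choose 2"
    using tn by (rule binomial_right_mono)
  then have "(2::nat) ^ (n choose 2) = 2 ^ (t choose 2) * 2 ^ ((n choose 2) - (t choose 2))"
    by (simp flip: power_add)
  ultimately have "2 ^ (t choose 2) \<le> 2 * (n choose t)"
    by (simp add: mult.commute mult.left_commute)
  also have "\<dots> \<le> 2 * n ^ t"
    using tn by (simp add: binomial_le_pow)
  finally show ?thesis .
qed

text \<open>Squaring avoids the half-integral exponent of \<open>2 powr (t / 2)\<close>. If the
  bound failed, the counting inequality would give \<open>t * (t - 1) \<le> 2 + (t - 2) * t\<close>,
  that is, \<open>t \<le> 2\<close>.\<close>

lemma ramsey_number_square_gt:
  assumes "t \<ge> 3"
  shows "2 ^ (t - 2) < (ramsey_number t)\<^sup>2"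
proof (rule ccontr)
  let ?r = "ramsey_number t"
  assume "\<not> ?thesis"
  then have "?r\<^sup>2 \<le> 2 ^ (t - 2)"
    by simp
  then have "(?r\<^sup>2) ^ t \<le> (2 ^ (t - 2)) ^ t"
    by (rule power_mono) simp
  then have r: "(?r ^ t)\<^sup>2 \<le> 2 ^ ((t - 2) * t)"
    by (simp add: power_mult[symmetric] mult.commute)
  have "(2 ^ (t choose 2)) \<le> 2 * ?r ^ t"
    by (rule partn_imp_pow_le[OF partn_ramsey_number])
  then have "(2 ^ (t choose 2))\<^sup>2 \<le> (2 * ?r ^ t)\<^sup>2"
    by (rule power_mono) simp
  also have "\<dots> \<le> 4 * 2 ^ ((t - 2) * t)"
    using r by (simp add: power_mult_distrib)
  finally have "(2::nat) ^ (2 * (t choose 2)) \<le> 2 ^ (2 + (t - 2) * t)"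
    by (simp add: power_add mult.commute flip: power_mult)
  then have "2 * (t choose 2) \<le> 2 + (t - 2) * t"
    by (rule power_le_imp_le_exp[rotated]) simp
  moreover have "even (t * (t - 1))"
    by (cases "even t") auto
  then have "2 * (t choose 2) = t * (t - 1)"
    by (simp add: choose_two)
  ultimately have "t * (t - 1) \<le> 2 + (t - 2) * t"
    by linarith
  moreover obtain k where "t = k + 3"
    using assms le_Suc_ex by (metis add.commute)
  ultimately show False
    by (simp add: algebra_simps)
qed

section \<open>Forcing positions\<close>

text \<open>A form of the game without strategies: \<open>n\<close> is an upper bound on the rounds
  still needed from position \<open>h\<close>. In this form, stages of Builder's plan
  compose.\<close>

primrec forces :: "(history \<Rightarrow> bool) \<Rightarrow> nat \<Rightarrow> history \<Rightarrow> bool" where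
  "forces P 0 h \<longleftrightarrow> P h"
| "forces P (Suc n) h \<longleftrightarrow> P h \<or>
     (\<exists>e \<in> nsets UNIV 2. e \<notin> fst ` set h \<and> (\<forall>c. forces P n (h @ [(e, c)])))"

lemma forces_now: "P h \<Longrightarrow> forces P n h"
  by (cases n) auto

text \<open>The second stage may depend on the position \<open>h'\<close> that Painter's answers
  lead to; only its budget \<open>m\<close> is uniform.\<close>

lemma forces_trans:
  assumes "forces Q n h" "\<And>h'. Q h' \<Longrightarrow> forces P m h'"
  shows "forces P (n + m) h"
  using assms(1)
proof (induction n arbitrary: h)
  case 0
  then show ?case using assms(2) by simp
next
  case (Suc n)
  show ?case
  proof (cases "Q h")
    case True
    then have "forces P m h" by (rule assms(2))
    \<comment> \<open>Monotonicity in the budget is proved on the spot, since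
      \<open>forces_mono\<close> is itself derived from this lemma.\<close>
    then have "forces P (m + k) h" for k
    proof (induction m arbitrary: h)
      case 0
      then show ?case by (simp add: forces_now)
    next
      case (Suc m)
      then show ?case by fastforce
    qed
    from this[of "Suc n"] show ?thesis by (simp add: add.commute)
  next
    case False
    with Suc show ?thesis by fastforce
  qed
qed

lemma forces_mono:
  assumes "forces P n h" "n \<le> n'"
  shows "forces P n' h"
  using forces_trans[OF assms(1), of P "n' - n"] assms(2) by (simp add: forces_now)

lemma exists_fresh_edge: "\<exists>e \<in> nsets UNIV 2. e \<notin> fst ` set (h :: history)"
proof -
  have "infinite (nsets (UNIV :: nat set) 2)"
    by (rule infinite_imp_infinite_nsets) auto
  moreover have "finite (fst ` set h)"
    by simp
  ultimately show ?thesis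
    by (meson finite_subset subsetI)
qed

lemma forces_imp_builder_wins:
  assumes "forces (\<lambda>h. has_mono_copy h G) n []"
  shows "builder_wins_within G n"
proof -
  let ?P = "\<lambda>h. has_mono_copy h G"
  \<comment> \<open>Builder moves so that the number of further rounds that suffice, \<open>rk\<close>, decreases.\<close>
  define rk where "rk h = (LEAST k. forces ?P k h)" for h
  \<comment> \<open>The last conjunct is vacuous if \<open>h\<close> is already won or no win can be
    forced from it. There only a fresh edge is demanded, which keeps \<open>\<sigma>\<close> legal
    on every history.\<close>
  define good where "good h e \<longleftrightarrow> e \<in> nsets UNIV 2 \<and> e \<notin> fst ` set h \<and>
      (\<forall>k. \<not> ?P h \<longrightarrow> forces ?P k h \<longrightarrow> (\<forall>c. forces ?P (rk h - 1) (h @ [(e, c)])))"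
    for h and e :: edge
  have "\<exists>e. good h e" for h
  proof (cases "\<not> ?P h \<and> (\<exists>k. forces ?P k h)")
    case True
    then have "forces ?P (rk h) h"
      unfolding rk_def by (metis LeastI)
    moreover from this True obtain k where "rk h = Suc k"
      by (cases "rk h") auto
    ultimately show ?thesis
      using True unfolding good_def by auto
  next
    case False
    then show ?thesis
      using exists_fresh_edge[of h] unfolding good_def by blast
  qed
  then obtain \<sigma> where \<sigma>: "good h (\<sigma> h)" for h
    by metis
  have "\<exists>k\<le>n. ?P (play \<sigma> \<tau> k)" for \<tau>
  proof (rule ccontr)
    assume no: "\<not> ?thesis"
    \<comment> \<open>For \<open>j = n\<close> the remaining budget is 0, so this says that Builder
      has won.\<close>
    have "forces ?P (n - j) (play \<sigma> \<tau> j)" if "j \<le> n" for j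
      using that
    proof (induction j)
      case 0
      with assms show ?case by simp
    next
      case (Suc j)
      let ?h = "play \<sigma> \<tau> j"
      have f: "forces ?P (n - j) ?h" and "\<not> ?P ?h"
        using Suc no by auto
      with \<sigma>[of ?h] have "forces ?P (rk ?h - 1) (play \<sigma> \<tau> (Suc j))"
        by (auto simp: good_def Let_def)
      moreover have "rk ?h \<le> n - j"
        unfolding rk_def using f by (rule Least_le)
      ultimately show ?case
        by (auto intro: forces_mono)
    qed
    from this[of n] no show False by auto
  qed
  moreover have "legal_builder \<sigma>"
    using \<sigma> by (auto simp: legal_builder_def good_def)
  ultimately show ?thesis
    unfolding builder_wins_within_def by blast
qed

text \<open>Edges of \<open>F\<close> already on the board are skipped, so \<open>card F\<close>
  rounds always suffice. Keeping the old coloured edges is what preserves the cliques built so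
  far.\<close>

lemma forces_draw:
  assumes "finite F" "F \<subseteq> nsets UNIV 2"
  shows "forces (\<lambda>h'. set h \<subseteq> set h' \<and> F \<subseteq> fst ` set h') (card F) h"
  using assms
proof (induction F arbitrary: h rule: finite_induct)
  case empty
  then show ?case by simp
next
  case (insert e F)
  let ?Q = "\<lambda>h h'. set h \<subseteq> set h' \<and> insert e F \<subseteq> fst ` set h'"
  have IH: "forces (\<lambda>h'. set h \<subseteq> set h' \<and> F \<subseteq> fst ` set h') (card F) h" for h
    using insert.IH insert.prems by simp
  have drawn: "forces (?Q h) (card F) h1" if "e \<in> fst ` set h1" "set h \<subseteq> set h1" for h1
  proof -
    have "forces (?Q h) (card F + 0) h1"
      by (rule forces_trans[OF IH[of h1]]) (use that in auto)
    then show ?thesis by simp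
  qed
  show ?case
  proof (cases "e \<in> fst ` set h")
    case True
    then have "forces (?Q h) (card F) h"
      by (intro drawn) auto
    then show ?thesis
      by (rule forces_mono) (simp add: insert.hyps)
  next
    case False
    have "forces (?Q h) (card F) (h @ [(e, c)])" for c
      by (rule drawn) auto
    with False insert.prems insert.hyps show ?thesis
      by auto
  qed
qed

section \<open>Builder's strategy\<close>

definition anchored :: "history \<Rightarrow> colour \<Rightarrow> nat \<Rightarrow> nat set \<Rightarrow> bool" where
  "anchored h c s S \<longleftrightarrow> (\<exists>A. finite A \<and> card A = s \<and> A \<inter> S = {} \<and>
     clique A (colour_class c h) \<and> (\<forall>x\<in>A. \<forall>y\<in>S. {x, y} \<in> colour_class c h))"

lemma anchored_0: "anchored h c 0 S"
  unfolding anchored_def by (intro exI[of _ "{}"]) auto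

lemma anchored_mono:
  assumes "anchored h c s S" "set h \<subseteq> set h'" "S' \<subseteq> S"
  shows "anchored h' c s S'"
proof -
  have "colour_class c h \<subseteq> colour_class c h'"
    using assms(2) by (auto simp: colour_class_def)
  with assms(1,3) show ?thesis
    unfolding anchored_def clique_def by (metis disjoint_iff subset_iff)
qed

text \<open>The vertex \<open>v\<close> moves from \<open>S\<close> into the clique, and
  \<open>S\<close> shrinks to neighbours of \<open>v\<close> in colour \<open>c\<close>.\<close>

lemma anchored_Suc:
  assumes "anchored h c s S" "v \<in> S" "S' \<subseteq> S - {v}"
    "\<And>y. y \<in> S' \<Longrightarrow> {v, y} \<in> colour_class c h"
  shows "anchored h c (Suc s) S'"
proof -
  obtain A where A: "finite A" "card A = s" "A \<inter> S = {}" "clique A (colour_class c h)"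
      "\<forall>x\<in>A. \<forall>y\<in>S. {x, y} \<in> colour_class c h"
    using assms(1) unfolding anchored_def by blast
  have "clique (insert v A) (colour_class c h)"
    using A(4,5) assms(2) by (auto simp: clique_def insert_commute)
  moreover have "v \<notin> A"
    using A(3) assms(2) by blast
  ultimately show ?thesis
    using A assms(2-) unfolding anchored_def
    by (intro exI[of _ "insert v A"]) auto
qed

lemma clique_imp_has_mono_copy:
  assumes "clique A (colour_class c h)" "finite A" "t \<le> card A"
  shows "has_mono_copy h (complete_graph t)"
proof -
  obtain \<phi> where \<phi>: "\<phi> ` {..<t} \<subseteq> A" "inj_on \<phi> {..<t}"
    using assms(2,3) card_le_inj[of "{..<t}" A] by auto
  have "\<phi> ` e \<in> colour_class c h" if e: "e \<in> nsets {..<t} 2" for e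
  proof -
    obtain x y where "e = {x, y}" "x \<in> {..<t}" "y \<in> {..<t}" "x \<noteq> y"
      using e by (elim nsets2_E) auto
    moreover from this have "\<phi> x \<noteq> \<phi> y"
      using \<phi>(2) by (auto dest: inj_onD)
    ultimately show ?thesis
      using assms(1) \<phi>(1) by (auto simp: clique_def)
  qed
  with \<phi>(2) show ?thesis
    unfolding has_mono_copy_def contains_copy_def complete_graph_def by auto
qed

lemma anchored_clique_imp_has_mono_copy:
  assumes "anchored h c s S" "C \<subseteq> S" "finite C" "clique C (colour_class c h)"
    "t \<le> s + card C"
  shows "has_mono_copy h (complete_graph t)"
proof -
  obtain A where A: "finite A" "card A = s" "A \<inter> S = {}" "clique A (colour_class c h)"
      "\<forall>x\<in>A. \<forall>y\<in>S. {x, y} \<in> colour_class c h"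
    using assms(1) unfolding anchored_def by blast
  have "clique (A \<union> C) (colour_class c h)"
    using A assms(2,4) by (intro clique_Un) auto
  moreover have "card (A \<union> C) = s + card C"
    using A assms(2,3) by (subst card_Un_disjoint) auto
  ultimately show ?thesis
    using clique_imp_has_mono_copy[of "A \<union> C" c h t] A(1) assms(3,5) by simp
qed

text \<open>The endgame: whichever colour the monochromatic \<open>k\<close>-set in \<open>S\<close>
  has, it extends the clique anchored in that colour to at least \<open>t\<close> vertices.\<close>

lemma forces_complete_stage:
  assumes "finite S" "ramsey_number k \<le> card S"
    "\<And>c. anchored h c (s c) S" "\<And>c. t \<le> s c + k"
  shows "forces (\<lambda>h. has_mono_copy h (complete_graph t)) (ramsey_number k choose 2) h"
proof -
  obtain S' where S': "S' \<subseteq> S" "card S' = ramsey_number k" "finite S'"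
    using assms(1,2) by (meson obtain_subset_with_card_n)
  have "forces (\<lambda>h'. set h \<subseteq> set h' \<and> nsets S' 2 \<subseteq> fst ` set h') (card (nsets S' 2)) h"
    using S'(3) by (intro forces_draw) (auto simp: finite_imp_finite_nsets nsets_def)
  then have "forces (\<lambda>h. has_mono_copy h (complete_graph t)) (card (nsets S' 2) + 0) h"
  proof (rule forces_trans)
    fix h' assume h': "set h \<subseteq> set h' \<and> nsets S' 2 \<subseteq> fst ` set h'"
    \<comment> \<open>An arbitrary history could list an edge under both colours, so one of its
      colours is chosen.\<close>
    define f where "f e = (SOME c. (e, c) \<in> set h')" for e
    have f: "(e, f e) \<in> set h'" if "e \<in> nsets S' 2" for e
    proof -
      from that h' have "e \<in> fst ` set h'" by blast
      then have "\<exists>c. (e, c) \<in> set h'" by force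
      then show ?thesis unfolding f_def by (rule someI_ex)
    qed
    obtain c C where C: "C \<in> nsets S' k" "\<And>e. e \<in> nsets C 2 \<Longrightarrow> f e = c"
      using ramsey_number_mono_subset[OF S'(3,2), of f] by blast
    then have C': "C \<subseteq> S'" "finite C" "card C = k"
      by (auto simp: nsets_def)
    have "clique C (colour_class c h')"
      unfolding clique_def colour_class_def
    proof clarify
      fix v w assume "v \<in> C" "w \<in> C" "v \<noteq> w"
      then have "{v, w} \<in> nsets C 2" by simp
      moreover from this C'(1) have "{v, w} \<in> nsets S' 2"
        using nsets_mono by blast
      ultimately show "({v, w}, c) \<in> set h'"
        using f C(2) by metis
    qed
    moreover have "anchored h' c (s c) S"
      using anchored_mono[OF assms(3)] h' by blast
    ultimately show "forces (\<lambda>h. has_mono_copy h (complete_graph t)) 0 h'"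
      using anchored_clique_imp_has_mono_copy[of h' c "s c" S C t] C' S'(1) assms(4)[of c]
      by auto
  qed
  then show ?thesis
    using S' by simp
qed

section \<open>Accounting for the shrinking of the active set\<close>

text \<open>The size factor held back for one colour whose clique has \<open>s\<close> vertices: 8/7
  for each growth up to \<open>t\<close>, and a further 10 for each growth up to \<open>m\<close>.
  Truncated subtraction removes the powers of 10 once \<open>m \<le> s\<close>.\<close>

definition reserve :: "nat \<Rightarrow> nat \<Rightarrow> nat \<Rightarrow> real" where
  "reserve t m s = 10 ^ (m - s) * (8 / 7) ^ (t - s)"

lemma reserve_ge_1: "1 \<le> reserve t m s"
proof -
  have "1 * (1::real) \<le> 10 ^ (m - s) * (8 / 7) ^ (t - s)"
    by (intro mult_mono one_le_power) auto
  then show ?thesis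
    by (simp add: reserve_def)
qed

lemma reserve_Suc:
  assumes "s < t"
  shows "reserve t m (Suc s) \<le> 7 / 8 * reserve t m s"
    and "s < m \<Longrightarrow> reserve t m (Suc s) \<le> 1 / 10 * reserve t m s"
proof -
  have t: "t - s = Suc (t - Suc s)"
    using assms by simp
  have "(10::real) ^ (m - Suc s) \<le> 10 ^ (m - s)"
    by (rule power_increasing) auto
  then show "reserve t m (Suc s) \<le> 7 / 8 * reserve t m s"
    unfolding reserve_def t by simp
  assume "s < m"
  then have m: "m - s = Suc (m - Suc s)"
    by simp
  show "reserve t m (Suc s) \<le> 1 / 10 * reserve t m s"
    unfolding reserve_def t m by simp
qed

text \<open>The sets \<open>D Red\<close>, \<open>D Blue\<close> are the two neighbourhoods of a vertex of \<open>S\<close>. Either one of them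
  contains a tenth of \<open>S\<close> in a colour that still needs to grow to \<open>m\<close>, or one of them contains
  almost everything; the loss is covered by the reserve in both cases.\<close>

lemma choose_colour:
  fixes S :: "nat set" and D :: "colour \<Rightarrow> nat set"
  assumes S: "reserve t m (s Red) * reserve t m (s Blue) * K \<le> card S" "40 \<le> card S"
    and D: "card S \<le> Suc (card (D Red) + card (D Blue))"
    and s: "\<And>c. s c < t" "\<exists>c. s c < m" and K: "0 \<le> K"
  obtains c where "reserve t m ((s(c := Suc (s c))) Red) * reserve t m ((s(c := Suc (s c))) Blue) * K
    \<le> card (D c)"
proof -
  note choose = that
  \<comment> \<open>Any colour works whose reserve drops at least by the factor \<open>q\<close>
    while its neighbourhood keeps a share \<open>q\<close> of \<open>S\<close>. It is used with
    \<open>q = 1 / 10\<close> and \<open>q = 7 / 8\<close>.\<close>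
  have step: thesis
    if c: "reserve t m (Suc (s c)) \<le> q * reserve t m (s c)" "q * card S \<le> card (D c)" "0 \<le> q"
    for c q
  proof -
    have nn: "0 \<le> reserve t m x" for x
      using reserve_ge_1[of t m x] by simp
    let ?s = "s(c := Suc (s c))"
    have "reserve t m (?s Red) * reserve t m (?s Blue)
        \<le> q * (reserve t m (s Red) * reserve t m (s Blue))"
    proof (cases c)
      case Red
      with mult_right_mono[OF c(1), of "reserve t m (s Blue)"] nn show ?thesis
        by (simp add: mult.assoc)
    next
      case Blue
      with mult_right_mono[OF c(1), of "reserve t m (s Red)"] nn show ?thesis
        by (simp add: ac_simps)
    qed
    then have "reserve t m (?s Red) * reserve t m (?s Blue) * K
        \<le> q * (reserve t m (s Red) * reserve t m (s Blue)) * K"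
      using K by (rule mult_right_mono)
    also have "\<dots> \<le> q * card S"
      using mult_left_mono[OF S(1) c(3)] by (simp add: mult.assoc)
    also have "\<dots> \<le> card (D c)"
      by (rule c(2))
    finally show thesis by (rule choose)
  qed
  show thesis
  proof (cases "\<exists>c. s c < m \<and> 1 / 10 * card S \<le> card (D c)")
    case True
    then show ?thesis
      using step reserve_Suc(2)[OF s(1)] by fastforce
  next
    case False
    \<comment> \<open>The other neighbourhood has at least \<open>9 / 10 * card S - 1\<close>
      vertices. As \<open>9 / 10 - 7 / 8 = 1 / 40\<close>, the bound \<open>40 \<le> card S\<close>
      absorbs the 1, which stands for the centre of the star.\<close>
    have "\<exists>c. 7 / 8 * card S \<le> card (D c)"
    proof -
      obtain c where "s c < m"
        using s(2) by blast
      with False have "card (D c) < 1 / 10 * card S"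
        by force
      moreover have "card S \<le> 1 + real (card (D Red)) + card (D Blue)"
        using D by linarith
      ultimately have "7 / 8 * card S \<le> card (D (case c of Red \<Rightarrow> Blue | Blue \<Rightarrow> Red))"
        using S(2) by (cases c) auto
      then show ?thesis by blast
    qed
    then show ?thesis
      using step reserve_Suc(1)[OF s(1)] by fastforce
  qed
qed

text \<open>Induction on the number of clique growths still possible. Each star costs at most
  \<open>N\<close> edges because \<open>S\<close> only shrinks, and the reserve keeps at least
  \<open>r(t - m)\<close> vertices for the endgame.\<close>

lemma forces_from_anchored:
  assumes "40 \<le> ramsey_number (t - m)" "m \<le> t"
    and "finite S" "card S \<le> N" "\<And>c. anchored h c (s c) S"
    and "reserve t m (s Red) * reserve t m (s Blue) * ramsey_number (t - m) \<le> card S"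
  shows "forces (\<lambda>h. has_mono_copy h (complete_graph t))
    (((t - s Red) + (t - s Blue)) * N + (ramsey_number (t - m) choose 2)) h"
  using assms(3-)
proof (induction "(t - s Red) + (t - s Blue)" arbitrary: s S h rule: less_induct)
  case less
  let ?P = "\<lambda>h. has_mono_copy h (complete_graph t)"
  let ?K = "ramsey_number (t - m)"
  let ?n = "\<lambda>s. (t - s Red) + (t - s Blue)"
  have "1 * real ?K \<le> reserve t m (s Red) * reserve t m (s Blue) * ?K"
    using mult_mono[OF reserve_ge_1[of t m "s Red"] reserve_ge_1[of t m "s Blue"]]
      reserve_ge_1[of t m "s Red"]
    by (intro mult_right_mono) auto
  with less.prems(4) have KS: "?K \<le> card S"
    by linarith
  consider (full) c where "t \<le> s c" | (stage) "\<And>c. m \<le> s c" |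
      (move) "\<And>c. s c < t" "\<exists>c. s c < m"
    by (meson not_le)
  then show ?case
  proof cases
    case full
    \<comment> \<open>One clique may reach \<open>t\<close> vertices before the other reaches
      \<open>m\<close>; it then wins by itself.\<close>
    have "?P h"
      using anchored_clique_imp_has_mono_copy[OF less.prems(3)[of c], of "{}"] full by simp
    then show ?thesis by (rule forces_now)
  next
    case stage
    have "t \<le> s c + (t - m)" for c
      using stage[of c] assms(2) by linarith
    from forces_complete_stage[OF less.prems(1) KS less.prems(3) this]
    show ?thesis by (rule forces_mono) simp
  next
    case move
    have "S \<noteq> {}"
      using KS assms(1) by auto
    then obtain v where v: "v \<in> S" by blast
    let ?F = "(\<lambda>y. {v, y}) ` (S - {v})"
    have "card ?F \<le> card S"
      using less.prems(1) by (meson card_Diff1_le card_image_le finite_Diff order_trans)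
    then have cF: "card ?F \<le> N"
      using less.prems(2) by linarith
    have "forces (\<lambda>h'. set h \<subseteq> set h' \<and> ?F \<subseteq> fst ` set h') (card ?F) h"
      using less.prems(1) by (intro forces_draw) auto
    then have "forces ?P (card ?F + ((?n s - 1) * N + (?K choose 2))) h"
    proof (rule forces_trans)
      fix h' assume h': "set h \<subseteq> set h' \<and> ?F \<subseteq> fst ` set h'"
      define D where "D c = {y \<in> S - {v}. {v, y} \<in> colour_class c h'}" for c
      have finD: "finite (D c)" for c
        using less.prems(1) by (simp add: D_def)
      have "S - {v} \<subseteq> D Red \<union> D Blue"
      proof
        fix y assume y: "y \<in> S - {v}"
        with h' have "{v, y} \<in> fst ` set h'" by blast
        then obtain c where "({v, y}, c) \<in> set h'" by force
        with y show "y \<in> D Red \<union> D Blue"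
          by (cases c) (auto simp: D_def colour_class_def)
      qed
      then have "card (S - {v}) \<le> card (D Red) + card (D Blue)"
        by (meson card_Un_le card_mono finD finite_UnI order_trans)
      then have "card S \<le> Suc (card (D Red) + card (D Blue))"
        using v less.prems(1) by (simp add: card_Diff_singleton)
      then obtain c where c: "reserve t m ((s(c := Suc (s c))) Red) *
          reserve t m ((s(c := Suc (s c))) Blue) * ?K \<le> card (D c)"
        using choose_colour[OF less.prems(4) _ _ move, of D] KS assms(1) by auto
      let ?s = "s(c := Suc (s c))"
      have D: "D c \<subseteq> S - {v}"
        by (auto simp: D_def)
      have anch: "anchored h' c' (s c') S" for c'
        using anchored_mono[OF less.prems(3)] h' by blast
      have "anchored h' c' (?s c') (D c)" for c'
      proof (cases "c' = c")
        case True
        have "anchored h' c (Suc (s c)) (D c)"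
          by (rule anchored_Suc[OF anch v D]) (auto simp: D_def)
        with True show ?thesis by simp
      next
        case False
        with D show ?thesis
          using anchored_mono[OF anch, of h' "D c"] by auto
      qed
      moreover have n: "?n ?s = ?n s - 1" "?n s \<noteq> 0"
        using move(1)[of Red] move(1)[of Blue] by (cases c; simp)+
      moreover have "card (D c) \<le> N"
        using card_mono[of S "D c"] D less.prems(1,2) by fastforce
      ultimately have "forces ?P (?n ?s * N + (?K choose 2)) h'"
        using less.hyps[of ?s "D c" h'] finD c by auto
      then show "forces ?P ((?n s - 1) * N + (?K choose 2)) h'"
        unfolding n(1) .
    qed
    moreover have "card ?F + ((?n s - 1) * N + (?K choose 2)) \<le> ?n s * N + (?K choose 2)"
    proof -
      obtain k where "?n s = Suc k"
        using move(1)[of Red] by (cases "?n s") auto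
      with cF show ?thesis by simp
    qed
    ultimately show ?thesis by (rule forces_mono)
  qed
qed

text \<open>Builder starts from \<open>S = {..<N}\<close> and two empty cliques. One reserve per
  colour explains the exponents \<open>2 * m\<close> and \<open>2 * t\<close>, and there are at most
  \<open>2 * t\<close> stars.\<close>

lemma online_ramsey_number_le:
  assumes "40 \<le> ramsey_number (t - m)" "m \<le> t"
    and "10 ^ (2 * m) * (8 / 7) ^ (2 * t) * real (ramsey_number (t - m)) \<le> real N"
  shows "online_ramsey_number t \<le> 2 * t * N + (ramsey_number (t - m) choose 2)"
proof -
  have "reserve t m 0 * reserve t m 0 = 10 ^ (2 * m) * (8 / 7) ^ (2 * t)"
    by (simp add: reserve_def mult_2 power_add)
  then have "forces (\<lambda>h. has_mono_copy h (complete_graph t))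
      (((t - 0) + (t - 0)) * N + (ramsey_number (t - m) choose 2)) []"
    using assms anchored_0
    by (intro forces_from_anchored[where s = "\<lambda>_. 0" and S = "{..<N}"]) auto
  then have "builder_wins_within (complete_graph t) (2 * t * N + (ramsey_number (t - m) choose 2))"
    by (intro forces_imp_builder_wins) (simp add: mult_2)
  then show ?thesis
    unfolding online_ramsey_def by (rule Least_le)
qed

section \<open>Infinitely many good values\<close>

lemma eventually_div_100:
  "\<forall>\<^sub>F m in sequentially. P m \<Longrightarrow> \<forall>\<^sub>F t in sequentially. P (t div 100)"
  by (rule eventually_compose_filterlim[OF _ filterlim_at_top_div_const_nat]) auto

text \<open>\<open>1.001 ^ 100 < 1.106 < 1.9\<close>, and rounding \<open>t\<close> up to a multiple
  of 100 costs only one extra factor 1.106.\<close>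

lemma eventually_growth_contraction:
  "\<forall>\<^sub>F t::nat in sequentially. 4 * (1.001::real) ^ t \<le> 1.9 ^ (t div 100)"
proof -
  have "\<forall>\<^sub>F m::nat in sequentially. 4 * (1.106::real) ^ (m + 1) \<le> 1.9 ^ m"
    by real_asymp
  from eventually_div_100[OF this] show ?thesis
  proof eventually_elim
    case (elim t)
    have "(1.001::real) ^ t \<le> 1.001 ^ (100 * (t div 100 + 1))"
      by (intro power_increasing) auto
    also have "\<dots> = (1.001 ^ 100) ^ (t div 100 + 1)"
      by (rule power_mult)
    also have "\<dots> \<le> 1.106 ^ (t div 100 + 1)"
      by (intro power_mono) (simp_all add: divide_simps)
    finally show ?case
      using elim by linarith
  qed
qed

lemma four_times_pow: "2 \<le> t \<Longrightarrow> (2::real) ^ t = 4 * 2 ^ (t - 2)"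
  by (auto simp: le_iff_add power_add)

text \<open>This pays for the stars. The loss per unit of \<open>t\<close> is below
  \<open>21 / 20 * (64 / 49) * 1.001 < 7 / 5\<close>, because \<open>100 < (21 / 20) ^ 100\<close>;
  and \<open>7 / 5\<close> lies below the square root of 2, the growth rate in the lower bound for
  \<open>r(t)\<close>.\<close>

lemma eventually_ramsey_number_ge_loss:
  "\<forall>\<^sub>F t in sequentially.
     32 * t * (10 ^ (2 * (t div 100)) * (8 / 7) ^ (2 * t)) * 1.001 ^ t \<le> real (ramsey_number t)"
proof -
  have "\<forall>\<^sub>F t::nat in sequentially. 
      32 * real t * (21 / 20 * (64 / 49) * 1.001) ^ t \<le> (7 / 5) ^ t"
    by real_asymp
  moreover have "\<forall>\<^sub>F t::nat in sequentially. 4 * (49 / 25) ^ t \<le> (2 :: real) ^ t"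
    by real_asymp
  ultimately show ?thesis
    using eventually_ge_at_top[of 3]
  proof eventually_elim
    case (elim t)
    let ?m = "t div 100"
    have "10 ^ (2 * ?m) = (100::real) ^ ?m"
      by (simp add: power_mult)
    also have "\<dots> \<le> ((21 / 20) ^ 100) ^ ?m"
      by (intro power_mono) (simp_all add: divide_simps)
    also have "\<dots> = (21 / 20) ^ (100 * ?m)"
      by (simp add: power_mult)
    also have "\<dots> \<le> (21 / 20) ^ t"
      by (intro power_increasing) auto
    finally have "32 * t * (10 ^ (2 * ?m) * (8 / 7) ^ (2 * t)) * 1.001 ^ t
        \<le> 32 * t * ((21 / 20) ^ t * ((64 / 49) ^ t)) * (1.001 ^ t :: real)"
      by (intro mult_right_mono mult_left_mono mult_mono) (auto simp: power_mult power2_eq_square)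
    also have "\<dots> \<le> (7 / 5) ^ t"
      using elim(1) by (simp only: power_mult_distrib mult.assoc)
    also have "\<dots> \<le> ramsey_number t"
    proof (rule power2_le_imp_le)
      have "real (2 ^ (t - 2)) < real ((ramsey_number t)\<^sup>2)"
        using ramsey_number_square_gt[OF elim(3)] by (simp only: of_nat_less_iff)
      moreover have "(2::real) ^ t = 4 * 2 ^ (t - 2)"
        using four_times_pow[of t] elim(3) by simp
      moreover have "((7 / 5 :: real) ^ t)\<^sup>2 = (49 / 25) ^ t"
        by (simp add: power2_eq_square flip: power_mult_distrib)
      ultimately show "((7 / 5) ^ t)\<^sup>2 \<le> (real (ramsey_number t))\<^sup>2"
        using elim(2) by simp
    qed simp
    finally show ?case .
  qed
qed

text \<open>After multiplication by \<open>1.001 ^ t\<close>, the stars and the endgame cost at most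
  \<open>r(t)\<^sup>2 / 8\<close> each, and \<open>r(t)\<^sup>2 / 4\<close> is at most
  \<open>r(t) choose 2\<close>.\<close>

lemma eventually_online_bound_if_growth:
  "\<forall>\<^sub>F t in sequentially.
     4 * 1.001 ^ t * (real (ramsey_number (t - t div 100)))\<^sup>2 \<le> (real (ramsey_number t))\<^sup>2 \<longrightarrow>
     real (online_ramsey_number t) \<le> 1.001 powr (- real t) * real (ramsey_number t choose 2)"
  using eventually_ramsey_number_ge_loss eventually_ge_at_top[of 50]
proof eventually_elim
  case (elim t)
  let ?m = "t div 100"
  let ?K = "real (ramsey_number (t - ?m))" and ?r = "real (ramsey_number t)"
  let ?c = "1.001 ^ t :: real"
  define L where "L = 10 ^ (2 * ?m) * (8 / 7 :: real) ^ (2 * t)"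
  define N where "N = nat \<lceil>L * ?K\<rceil>"
  show ?case
  proof
    assume growth: "4 * ?c * ?K\<^sup>2 \<le> ?r\<^sup>2"
    have K40: "40 \<le> ramsey_number (t - ?m)"
      using ramsey_number_ge[of "t - ?m"] elim(2) by linarith
    have c1: "1 \<le> ?c"
      by (rule one_le_power) simp
    have L1: "1 \<le> L"
      unfolding L_def using mult_mono[of 1 "10 ^ (2 * ?m) :: real" 1 "(8 / 7) ^ (2 * t)"]
      by (simp add: one_le_power)
    have "1 * 1 \<le> L * ?K"
      using L1 K40 by (intro mult_mono) auto
    \<comment> \<open>Rounding up at most doubles a real number that is at least 1.\<close>
    then have N: "real N \<le> 2 * (L * ?K)"
      unfolding N_def by linarith
    have "?K\<^sup>2 \<le> ?c * ?K\<^sup>2"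
      using mult_right_mono[OF c1, of "?K\<^sup>2"] by simp
    with growth have "?K\<^sup>2 \<le> ?r\<^sup>2"
      using zero_le_power2[of ?K] by linarith
    then have Kr: "?K \<le> ?r"
      by (rule power2_le_imp_le) simp
    have "L * ?K \<le> L * ?r"
      using Kr L1 by (intro mult_left_mono) auto
    with N have "real N \<le> 2 * (L * ?r)"
      by linarith
    then have "?c * (2 * t * real N) \<le> ?c * (2 * t * (2 * (L * ?r)))"
      using c1 by (intro mult_left_mono) auto
    \<comment> \<open>The constant 32 in the loss estimate was chosen to leave exactly the factor
      1/8 here.\<close>
    also have "\<dots> = (32 * t * L * ?c) * ?r / 8"
      by (simp add: field_simps)
    also have "\<dots> \<le> ?r * ?r / 8"
      using elim(1) by (intro divide_right_mono mult_right_mono) (auto simp: L_def)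
    finally have star_cost: "?c * (2 * t * real N) \<le> ?r\<^sup>2 / 8"
      by (simp add: power2_eq_square)
    have choose: "real (n choose 2) = n * (real n - 1) / 2" for n
    proof -
      have "real (n choose 2) = (real n) gchoose 2"
        by (rule binomial_gbinomial)
      then show ?thesis
        by (simp add: gbinomial_prod_rev numeral_2_eq_2 algebra_simps)
    qed
    have "real (ramsey_number (t - ?m) choose 2) \<le> ?K\<^sup>2 / 2"
      by (simp add: choose power2_eq_square algebra_simps)
    then have "?c * real (ramsey_number (t - ?m) choose 2) \<le> ?c * (?K\<^sup>2 / 2)"
      using c1 by (intro mult_left_mono) auto
    also have "\<dots> \<le> ?r\<^sup>2 / 8"
      using growth by (simp add: ac_simps)
    finally have end_cost: "?c * real (ramsey_number (t - ?m) choose 2) \<le> ?r\<^sup>2 / 8" .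
    have "2 * ?r \<le> ?r * ?r"
      using Kr K40 by (intro mult_right_mono) auto
    then have r: "?r\<^sup>2 / 4 \<le> real (ramsey_number t choose 2)"
      by (simp add: choose power2_eq_square algebra_simps)
    have "L * ?K \<le> real N"
      unfolding N_def by linarith
    then have "online_ramsey_number t \<le> 2 * t * N + (ramsey_number (t - ?m) choose 2)"
      unfolding L_def by (intro online_ramsey_number_le K40) auto
    then have "real (online_ramsey_number t)
        \<le> real (2 * t * N + (ramsey_number (t - ?m) choose 2))"
      by (simp only: of_nat_le_iff)
    then have "real (online_ramsey_number t)
        \<le> 2 * t * real N + real (ramsey_number (t - ?m) choose 2)"
      by simp
    then have "?c * real (online_ramsey_number t)
        \<le> ?c * (2 * t * real N + real (ramsey_number (t - ?m) choose 2))"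
      using c1 by (intro mult_left_mono) auto
    also have "\<dots> \<le> real (ramsey_number t choose 2)"
      using star_cost end_cost r by (simp only: distrib_left)
    finally show "real (online_ramsey_number t)
        \<le> 1.001 powr (- real t) * real (ramsey_number t choose 2)"
      by (simp add: powr_minus powr_realpow field_simps)
  qed
qed

text \<open>Otherwise \<open>(ramsey_number t)\<^sup>2\<close> would grow at most like \<open>1.9 ^ t\<close>, contradicting
  the lower bound \<open>2 ^ (t - 2)\<close>.\<close>

lemma frequently_growth:
  "\<exists>\<^sub>F t in sequentially.
     4 * 1.001 ^ t * (real (ramsey_number (t - t div 100)))\<^sup>2 \<le> (real (ramsey_number t))\<^sup>2"
proof (rule ccontr)
  let ?r = "\<lambda>t. (real (ramsey_number t))\<^sup>2"
  assume "\<not> ?thesis"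
  then have "\<forall>\<^sub>F t in sequentially. ?r t < 4 * 1.001 ^ t * ?r (t - t div 100)"
    by (simp add: not_frequently not_le)
  then have "\<forall>\<^sub>F t in sequentially. ?r t \<le> 1.9 ^ (t div 100) * ?r (t - t div 100)"
    using eventually_growth_contraction
  proof eventually_elim
    case (elim t)
    from mult_right_mono[OF elim(2), of "?r (t - t div 100)"] elim(1) show ?case by simp
  qed
  then obtain T where T: "\<And>t. T \<le> t \<Longrightarrow> ?r t \<le> 1.9 ^ (t div 100) * ?r (t - t div 100)"
    unfolding eventually_sequentially by blast
  \<comment> \<open>\<open>C\<close> dominates all initial values. The range reaches beyond 100 so
    that \<open>t div 100\<close> is positive afterwards and the recursion descends
    strictly.\<close>
  define C where "C = (\<Sum>s < T + 100. ?r s)"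
  have C0: "0 \<le> C"
    unfolding C_def by (intro sum_nonneg) auto
  have upper: "?r t \<le> C * 1.9 ^ t" for t
  proof (induction t rule: less_induct)
    case (less t)
    show ?case
    proof (cases "t < T + 100")
      case True
      then have "?r t \<le> C"
        unfolding C_def by (intro member_le_sum) auto
      also have "\<dots> \<le> C * 1.9 ^ t"
        using mult_left_mono[OF one_le_power[of "1.9::real" t] C0] by simp
      finally show ?thesis .
    next
      case False
      then have "?r t \<le> 1.9 ^ (t div 100) * ?r (t - t div 100)"
        by (intro T) simp
      also have "\<dots> \<le> 1.9 ^ (t div 100) * (C * 1.9 ^ (t - t div 100))"
        using False by (intro mult_left_mono less.IH) (auto simp: div_greater_zero_iff)
      also have "\<dots> = C * (1.9 ^ (t div 100) * 1.9 ^ (t - t div 100))"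
        by (simp only: mult.left_commute)
      also have "(1.9::real) ^ (t div 100) * 1.9 ^ (t - t div 100) = 1.9 ^ t"
        by (subst power_add[symmetric]) simp
      finally show ?thesis .
    qed
  qed
  have "\<forall>\<^sub>F t::nat in sequentially. 4 * (C * 1.9 ^ t) \<le> 2 ^ t"
    by real_asymp
  then have "\<forall>\<^sub>F t::nat in sequentially. False"
    using eventually_ge_at_top[of 3]
  proof eventually_elim
    case (elim t)
    have "real (2 ^ (t - 2)) < real ((ramsey_number t)\<^sup>2)"
      using ramsey_number_square_gt[OF elim(2)] by (simp only: of_nat_less_iff)
    moreover have "(2::real) ^ t = 4 * 2 ^ (t - 2)"
      using four_times_pow[of t] elim(2) by simp
    ultimately show False
      using elim(1) upper[of t] by simp
  qed
  then show False
    by simp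
qed

theorem theorem4:
  shows "infinite {t :: nat. t > 0 \<and>
    real (online_ramsey_number t) \<le> 1.001 powr (- real t) * real (ramsey_number t choose 2)}"
proof -
  have "\<exists>\<^sub>F t in sequentially. t > 0 \<and>
      real (online_ramsey_number t) \<le> 1.001 powr (- real t) * real (ramsey_number t choose 2)"
  proof (rule frequently_rev_mp[OF frequently_growth])
    show "\<forall>\<^sub>F t in sequentially.
        4 * 1.001 ^ t * (real (ramsey_number (t - t div 100)))\<^sup>2 \<le> (real (ramsey_number t))\<^sup>2 \<longrightarrow>
        t > 0 \<and> real (online_ramsey_number t)
          \<le> 1.001 powr (- real t) * real (ramsey_number t choose 2)"
      using eventually_online_bound_if_growth eventually_gt_at_top[of 0]
      by eventually_elim auto
  qed
  \<comment> \<open>Occurring frequently along \<open>sequentially\<close>, which is the cofinite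
    filter on \<open>nat\<close>, means holding on an infinite set.\<close>
  then show ?thesis
    by (simp add: frequently_cofinite flip: cofinite_eq_sequentially)
qed

end
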